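(* Let $\mathbf{w}=(w_1,\dots,w_n)$ be any vector of generic entitlements. Then any algorithm that decides whether a connected strongly-proportional allocation exists for $n$ hungry agents with entitlements $\mathbf{w}$ requires at least $n\cdot 2^{n-2}$ queries.
   Context: The cake is $C=[0,1]$, to be divided among agents $[n]$. Each agent $i$ has a valuation function $V_i$ on the algebra generated by intervals of $C$ that is non-negative, finitely additive, normalized ($V_i(C)=1$), with $x\mapsto V_i([0,x])$ continuous. Agent $i$ is hungry if $V_i(X)>0$ for every interval $X$ of positive length. Entitlements are $w_i>0$ with $\sum_i w_i=1$; for $N\subseteq[n]$ let $w_N=\sum_{i\in N}w_i$. The entitlements are generic if $w_N\neq w_{N'}$ for all distinct $N,N'\subseteq[n]$. An allocation is a partition $C=X_1\sqcup\cdots\sqcup X_n$ into finite unions of closed intervals, pairwise disjoint except possibly at endpoints; it is connected if each $X_i$ is a single interval and strongly-proportional if $V_i(X_i)>w_i$ for all $i$. Algorithms access valuations only via queries (each counts as one): $\textsc{Eval}_i(x,y)=V_i([x,y])$; $\textsc{Mark}_i(x,r)$ returns the largest $z\in C$ with $V_i([x,z])=r$, or $\infty$ if $V_i([x,1])<r$.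
   Formalization: The formal theorem assumes n ≥ 2; for n = 1 the claim fails, since w_1 = 1 and V_1(C) = 1 make the answer always "no", so 0 queries suffice although n·2^(n-2) = 1/2. *)

theory Defs
  imports "HOL-Analysis.Analysis"
begin

definition cake :: "real set" where
  "cake = {0..1}"

definition cake_intervals :: "real set set" where
  "cake_intervals = {X. X \<subseteq> cake \<and> is_interval X}"

definition cake_algebra :: "real set set" where
  "cake_algebra = \<Inter>{M. algebra cake M \<and> cake_intervals \<subseteq> M}"

text \<open>Valuations are total functions on \<^typ>\<open>real set\<close>; only their values on
  \<^const>\<open>cake_algebra\<close> are constrained, and only those are ever used.\<close>

definition valuation :: "(real set \<Rightarrow> real) \<Rightarrow> bool" where
  "valuation V \<longleftrightarrow>
     (\<forall>X\<in>cake_algebra. 0 \<le> V X) \<and>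
     additive cake_algebra V \<and>
     V cake = 1 \<and>
     continuous_on cake (\<lambda>x. V {0..x})"

definition hungry :: "(real set \<Rightarrow> real) \<Rightarrow> bool" where
  "hungry V \<longleftrightarrow> (\<forall>X\<in>cake_intervals. 0 < measure lborel X \<longrightarrow> 0 < V X)"

definition hungry_profile :: "nat \<Rightarrow> (nat \<Rightarrow> real set \<Rightarrow> real) \<Rightarrow> bool" where
  "hungry_profile n V \<longleftrightarrow> (\<forall>i\<in>{1..n}. valuation (V i) \<and> hungry (V i))"

definition entitlements :: "nat \<Rightarrow> (nat \<Rightarrow> real) \<Rightarrow> bool" where
  "entitlements n w \<longleftrightarrow> (\<forall>i\<in>{1..n}. 0 < w i) \<and> sum w {1..n} = 1"

definition generic :: "nat \<Rightarrow> (nat \<Rightarrow> real) \<Rightarrow> bool" where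
  "generic n w \<longleftrightarrow>
     (\<forall>N N'. N \<subseteq> {1..n} \<and> N' \<subseteq> {1..n} \<and> N \<noteq> N' \<longrightarrow> sum w N \<noteq> sum w N')"

definition closed_intervals :: "real set set" where
  "closed_intervals = {{a..b} | a b. 0 \<le> a \<and> a \<le> b \<and> b \<le> 1}"

text \<open>The frontier of a finite union of closed intervals is the set of its endpoints.\<close>

definition allocation :: "nat \<Rightarrow> (nat \<Rightarrow> real set) \<Rightarrow> bool" where
  "allocation n X \<longleftrightarrow>
     (\<Union>i\<in>{1..n}. X i) = cake \<and>
     (\<forall>i\<in>{1..n}. \<exists>\<I>. finite \<I> \<and> \<I> \<subseteq> closed_intervals \<and> X i = \<Union>\<I>) \<and>
     (\<forall>i\<in>{1..n}. \<forall>j\<in>{1..n}. i \<noteq> j \<longrightarrow> X i \<inter> X j \<subseteq> frontier (X i) \<inter> frontier (X j))"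

definition connected_allocation :: "nat \<Rightarrow> (nat \<Rightarrow> real set) \<Rightarrow> bool" where
  "connected_allocation n X \<longleftrightarrow> allocation n X \<and> (\<forall>i\<in>{1..n}. X i \<in> closed_intervals)"

definition strongly_proportional ::
  "nat \<Rightarrow> (nat \<Rightarrow> real) \<Rightarrow> (nat \<Rightarrow> real set \<Rightarrow> real) \<Rightarrow> (nat \<Rightarrow> real set) \<Rightarrow> bool" where
  "strongly_proportional n w V X \<longleftrightarrow> (\<forall>i\<in>{1..n}. w i < V i (X i))"

datatype query = Eval nat real real | Mark nat real real

fun legal_query :: "nat \<Rightarrow> query \<Rightarrow> bool" where
  "legal_query n (Eval i x y) \<longleftrightarrow> i \<in> {1..n} \<and> 0 \<le> x \<and> x \<le> y \<and> y \<le> 1"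
| "legal_query n (Mark i x r) \<longleftrightarrow> i \<in> {1..n} \<and> x \<in> cake \<and> 0 \<le> r"

fun answer :: "(nat \<Rightarrow> real set \<Rightarrow> real) \<Rightarrow> query \<Rightarrow> ereal" where
  "answer V (Eval i x y) = ereal (V i {x..y})"
| "answer V (Mark i x r) =
     (if V i {x..1} < r then \<infinity>
      else ereal (GREATEST z. z \<in> cake \<and> x \<le> z \<and> V i {x..z} = r))"

text \<open>A (deterministic, adaptive) algorithm is a strategy: from the transcript of the queries made
  so far and their answers it determines the next query or the final verdict. No computability
  or termination is built in.\<close>

datatype action = Ask query | Output bool

type_synonym transcript = "(query \<times> ereal) list"

type_synonym algorithm = "transcript \<Rightarrow> action"

inductive reaches :: "nat \<Rightarrow> algorithm \<Rightarrow> (nat \<Rightarrow> real set \<Rightarrow> real) \<Rightarrow> transcript \<Rightarrow> bool"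
  for n A V where
  start: "reaches n A V []"
| step: "reaches n A V h \<Longrightarrow> A h = Ask q \<Longrightarrow> legal_query n q \<Longrightarrow>
         reaches n A V (h @ [(q, answer V q)])"

text \<open>For given \<^term>\<open>A\<close> and \<^term>\<open>V\<close> there is at most one halting transcript \<^term>\<open>h\<close>; its length is the
  number of queries made.\<close>

definition halts ::
  "nat \<Rightarrow> algorithm \<Rightarrow> (nat \<Rightarrow> real set \<Rightarrow> real) \<Rightarrow> transcript \<Rightarrow> bool \<Rightarrow> bool" where
  "halts n A V h b \<longleftrightarrow> reaches n A V h \<and> A h = Output b"

definition decides_connected_strongly_proportional ::
  "nat \<Rightarrow> (nat \<Rightarrow> real) \<Rightarrow> algorithm \<Rightarrow> bool" where
  "decides_connected_strongly_proportional n w A \<longleftrightarrow>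
     (\<forall>V. hungry_profile n V \<longrightarrow>
        (\<exists>h. halts n A V h
               (\<exists>X. connected_allocation n X \<and> strongly_proportional n w V X)))"

end

theory Submission
  imports Defs
begin

text \<open>The adversary answers every query as if all valuations were Lebesgue measure, for which no
  connected strongly-proportional allocation exists. A query to agent \<open>i\<close> involves only two points
  of the cake, so after fewer than \<open>n * 2 ^ (n - 2)\<close> queries some agent \<open>i\<close> has been asked about fewer
  than \<open>2 ^ (n - 1)\<close> points. By genericity one of the \<open>2 ^ n - 2\<close> points \<open>p = w\<^sub>M\<close>, for \<open>M\<close> a nonempty
  proper subset of the agents, is not among them. Shifting a little of agent \<open>i\<close>'s value across \<open>p\<close>
  changes no answer, but makes the interval of length \<open>w\<^sub>i\<close> with endpoint \<open>p\<close>, to the right of \<open>p\<close> if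
  \<open>i \<notin> M\<close> and to its left otherwise, worth more than \<open>w\<^sub>i\<close>. Agent \<open>i\<close> can then leave some cake to
  each of the other agents, who are served in an order in which those of \<open>M - {i}\<close> come first and the
  remaining ones come after \<open>i\<close>.\<close>

section \<open>Perturbed Lebesgue measure\<close>

text \<open>The density is \<open>1 + s\<close> on \<open>{p - d..p}\<close>, \<open>1 - s\<close> on \<open>{p..p + d}\<close> and \<open>1\<close> elsewhere.\<close>

definition tent_val :: "real \<Rightarrow> real \<Rightarrow> real \<Rightarrow> real set \<Rightarrow> real" where
  "tent_val p d s X =
     measure lborel X + s * (measure lborel (X \<inter> {p - d..p}) - measure lborel (X \<inter> {p..p + d}))"

text \<open>An antiderivative of the density: the identity plus a tent of height
  \<open>s * d\<close> supported on \<open>{p - d..p + d}\<close>. Positive \<open>s\<close> moves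
  value to the left of \<open>p\<close>, negative \<open>s\<close> to the right.\<close>

definition tent_cdf :: "real \<Rightarrow> real \<Rightarrow> real \<Rightarrow> real \<Rightarrow> real" where
  "tent_cdf p d s x = x + s * max 0 (d - \<bar>x - p\<bar>)"

lemma tent_val_0: "tent_val p d 0 = measure lborel"
  by (simp add: tent_val_def fun_eq_iff)

lemma tent_cdf_eq_self: "d \<le> \<bar>x - p\<bar> \<Longrightarrow> tent_cdf p d s x = x"
  by (simp add: tent_cdf_def)

text \<open>The tent is 1-Lipschitz, so every slope lies between \<open>1 - \<bar>s\<bar>\<close>
  and \<open>1 + \<bar>s\<bar>\<close>. The lower bound makes marks unique; the upper one limits
  what trimming an interval can cost.\<close>

lemma tent_cdf_diff_bounds:
  assumes "\<bar>s\<bar> \<le> 1/2" "x \<le> y"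
  shows "(y - x) / 2 \<le> tent_cdf p d s y - tent_cdf p d s x"
    and "tent_cdf p d s y - tent_cdf p d s x \<le> 2 * (y - x)"
proof -
  define D where "D = max 0 (d - \<bar>y - p\<bar>) - max 0 (d - \<bar>x - p\<bar>)"
  have "\<bar>D\<bar> \<le> y - x" using assms(2) unfolding D_def by linarith
  then have "\<bar>s * D\<bar> \<le> (1/2) * (y - x)"
    unfolding abs_mult using assms by (intro mult_mono) auto
  moreover have "tent_cdf p d s y - tent_cdf p d s x = (y - x) + s * D"
    by (simp add: tent_cdf_def D_def algebra_simps)
  ultimately show "(y - x) / 2 \<le> tent_cdf p d s y - tent_cdf p d s x"
    and "tent_cdf p d s y - tent_cdf p d s x \<le> 2 * (y - x)"
    using assms(2) by simp_all
qed

lemma tent_cdf_inject: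
  assumes "\<bar>s\<bar> \<le> 1/2"
  shows "tent_cdf p d s x = tent_cdf p d s y \<longleftrightarrow> x = y"
  using tent_cdf_diff_bounds(1)[OF assms, of x y p d] tent_cdf_diff_bounds(1)[OF assms, of y x p d]
  by (cases "x \<le> y") auto

lemma measure_lborel_Icc_max: "measure lborel {a..b} = max 0 (b - a :: real)"
  by (cases "a \<le> b") auto

lemma tent_val_Icc:
  assumes "x \<le> y" "0 \<le> d"
  shows "tent_val p d s {x..y} = tent_cdf p d s y - tent_cdf p d s x"
proof -
  have "measure lborel ({x..y} \<inter> {p - d..p}) - measure lborel ({x..y} \<inter> {p..p + d})
      = max 0 (d - \<bar>y - p\<bar>) - max 0 (d - \<bar>x - p\<bar>)"
    unfolding Int_atLeastAtMost measure_lborel_Icc_max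
    using assms by (auto simp: max_def min_def abs_if)
  then show ?thesis
    unfolding tent_val_def tent_cdf_def using assms(1)
    by (simp only: measure_lborel_Icc_max) (simp add: algebra_simps)
qed

lemma algebra_borel_cake: "algebra cake {X \<in> sets borel. X \<subseteq> cake}"
  by (rule algebra_iff_Un[THEN iffD2]) (auto simp: cake_def)

text \<open>The Borel subsets of the cake form one of the algebras being intersected. Hence facts
  about Lebesgue measure apply to every set in \<open>cake_algebra\<close>.\<close>

lemma cake_algebra_borel:
  assumes "X \<in> cake_algebra"
  shows "X \<in> sets borel" "X \<subseteq> cake"
proof -
  have "cake_intervals \<subseteq> {X \<in> sets borel. X \<subseteq> cake}"
    using real_interval_borel_measurable by (auto simp: cake_intervals_def is_interval_convex)
  with algebra_borel_cake assms have "X \<in> {X \<in> sets borel. X \<subseteq> cake}"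
    unfolding cake_algebra_def by blast
  then show "X \<in> sets borel" "X \<subseteq> cake" by auto
qed

lemma fmeasurable_lborel_subset_cake:
  assumes "X \<in> sets borel" "X \<subseteq> cake"
  shows "X \<in> fmeasurable lborel"
proof (rule fmeasurableI2)
  show "cake \<in> fmeasurable lborel" by (simp add: cake_def fmeasurable_def)
qed (use assms in auto)

text \<open>Both correction terms lie between 0 and the measure of \<open>X\<close>, hence so does
  the absolute value of their difference. Non-negativity and hunger both follow from this
  bound.\<close>

lemma tent_val_ge:
  assumes "\<bar>s\<bar> \<le> 1/2" "X \<in> sets borel" "X \<subseteq> cake"
  shows "measure lborel X / 2 \<le> tent_val p d s X"
proof -
  define D where "D = measure lborel (X \<inter> {p - d..p}) - measure lborel (X \<inter> {p..p + d})"
  have X: "X \<in> fmeasurable lborel" using fmeasurable_lborel_subset_cake assms by blast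
  have le: "measure lborel (X \<inter> T) \<le> measure lborel X" if "T \<in> sets borel" for T
    using X that assms by (intro measure_mono_fmeasurable) auto
  have "\<bar>D\<bar> \<le> measure lborel X"
    using le[of "{p - d..p}", simplified] le[of "{p..p + d}", simplified]
      measure_nonneg[of lborel "X \<inter> {p - d..p}"] measure_nonneg[of lborel "X \<inter> {p..p + d}"]
    unfolding D_def by linarith
  then have "\<bar>s * D\<bar> \<le> (1/2) * measure lborel X"
    unfolding abs_mult using assms by (intro mult_mono) auto
  then show ?thesis
    unfolding tent_val_def D_def[symmetric] by linarith
qed

lemma additive_tent_val: "additive cake_algebra (tent_val p d s)"
  unfolding additive_def
proof (intro ballI impI)
  fix X Y assume XY: "X \<in> cake_algebra" "Y \<in> cake_algebra" "X \<inter> Y = {}"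
  have "measure lborel ((X \<union> Y) \<inter> T) = measure lborel (X \<inter> T) + measure lborel (Y \<inter> T)"
    if "T \<in> sets borel" for T
  proof -
    have "X \<inter> T \<in> fmeasurable lborel" "Y \<inter> T \<in> fmeasurable lborel"
      using XY cake_algebra_borel that by (auto intro!: fmeasurable_lborel_subset_cake)
    moreover have "(X \<inter> T) \<inter> (Y \<inter> T) = {}" using XY(3) by blast
    ultimately show ?thesis
      by (simp add: Int_Un_distrib2 measure_Un3)
  qed
  from this[of UNIV] this[of "{p - d..p}"] this[of "{p..p + d}"]
  show "tent_val p d s (X \<union> Y) = tent_val p d s X + tent_val p d s Y"
    by (simp add: tent_val_def algebra_simps)
qed

lemma valuation_tent_val:
  assumes "\<bar>s\<bar> \<le> 1/2" "0 \<le> d" "d \<le> p" "p + d \<le> 1"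
  shows "valuation (tent_val p d s)"
  unfolding valuation_def
proof (intro conjI ballI)
  fix X assume "X \<in> cake_algebra"
  then show "0 \<le> tent_val p d s X"
    using tent_val_ge[OF assms(1), of X p d] cake_algebra_borel[of X]
      measure_nonneg[of lborel X] by linarith
next
  show "additive cake_algebra (tent_val p d s)" by (rule additive_tent_val)
next
  \<comment> \<open>The tent fits inside the cake, so it vanishes at 0 and 1.\<close>
  show "tent_val p d s cake = 1"
    using assms by (simp add: cake_def tent_val_Icc tent_cdf_eq_self)
next
  have "continuous_on cake (\<lambda>x. tent_cdf p d s x - tent_cdf p d s 0)"
    unfolding tent_cdf_def by (intro continuous_intros)
  then show "continuous_on cake (\<lambda>x. tent_val p d s {0..x})"
    by (rule continuous_on_eq) (use assms(2) in \<open>auto simp: cake_def tent_val_Icc\<close>)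
qed

lemma hungry_tent_val:
  assumes "\<bar>s\<bar> \<le> 1/2"
  shows "hungry (tent_val p d s)"
  unfolding hungry_def
proof (intro ballI impI)
  fix X assume X: "X \<in> cake_intervals" "0 < measure lborel X"
  then have "X \<in> sets borel" "X \<subseteq> cake"
    using real_interval_borel_measurable by (auto simp: cake_intervals_def is_interval_convex)
  then show "0 < tent_val p d s X"
    using tent_val_ge[OF assms, of X p d] X(2) by simp
qed

section \<open>Queries\<close>

fun query_agent :: "query \<Rightarrow> nat" where
  "query_agent (Eval i x y) = i"
| "query_agent (Mark i x r) = i"

text \<open>For \<open>Mark\<close>, the second point is the mark under Lebesgue measure; it may lie
  beyond the cake, in which case the answer is infinite.\<close>

fun query_points :: "query \<Rightarrow> real set" where
  "query_points (Eval i x y) = {x, y}"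
| "query_points (Mark i x r) = {x, x + r}"

lemma answer_cong_agent:
  "V (query_agent q) = V' (query_agent q) \<Longrightarrow> answer V q = answer V' q"
  by (cases q) auto

text \<open>At points outside the tent \<open>tent_cdf\<close> is the identity. The right-hand side
  is free of \<open>p\<close>, \<open>d\<close> and \<open>s\<close>, so the case
  \<open>s = 0\<close> shows that the answer is the one for Lebesgue measure.\<close>

lemma answer_tent_val:
  assumes "\<bar>s\<bar> \<le> 1/2" "0 \<le> d" "d \<le> p" "p + d \<le> 1"
    and V: "V (query_agent q) = tent_val p d s"
    and legal: "legal_query n q"
    and far: "\<And>x. x \<in> query_points q \<Longrightarrow> d \<le> \<bar>x - p\<bar>"
  shows "answer V q = (case q of Eval i x y \<Rightarrow> ereal (y - x)
    | Mark i x r \<Rightarrow> if 1 - x < r then \<infinity> else ereal (x + r))"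
proof (cases q)
  case (Eval i x y)
  then show ?thesis
    using assms by (auto simp: tent_val_Icc tent_cdf_eq_self)
next
  case (Mark i x r)
  have x: "0 \<le> x" "x \<le> 1" "0 \<le> r" using legal Mark by (auto simp: cake_def)
  have F: "tent_cdf p d s x = x" "tent_cdf p d s (x + r) = x + r" "tent_cdf p d s 1 = 1"
    using far Mark assms by (auto simp: tent_cdf_eq_self)
  have V1: "V i {x..1} = 1 - x"
    using V Mark x assms F by (simp add: tent_val_Icc)
  \<comment> \<open>\<open>tent_cdf\<close> is injective, so \<open>GREATEST\<close> ranges over a
    single point.\<close>
  have "(z \<in> cake \<and> x \<le> z \<and> V i {x..z} = r) \<longleftrightarrow> z = x + r" if "\<not> 1 - x < r" for z
  proof (cases "x \<le> z")
    case True
    then have "V i {x..z} = tent_cdf p d s z - x"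
      using V Mark assms F by (simp add: tent_val_Icc)
    then have "V i {x..z} = r \<longleftrightarrow> tent_cdf p d s z = tent_cdf p d s (x + r)"
      using F by auto
    then show ?thesis
      using x that True by (auto simp: tent_cdf_inject[OF assms(1)] cake_def)
  qed (use x in auto)
  then have "(GREATEST z. z \<in> cake \<and> x \<le> z \<and> V i {x..z} = r) = x + r" if "\<not> 1 - x < r"
    using that by (auto intro: Greatest_equality)
  then show ?thesis using Mark V1 by simp
qed

lemma reaches_legal:
  "reaches n A V h \<Longrightarrow> (q, a) \<in> set h \<Longrightarrow> legal_query n q"
  by (induction rule: reaches.induct) auto

text \<open>A strategy sees the valuations only through the answers, so a run carries over to any
  profile that gives the same ones.\<close>

lemma reaches_cong:
  assumes "reaches n A V h" "\<And>q a. (q, a) \<in> set h \<Longrightarrow> answer V q = answer V' q"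
  shows "reaches n A V' h"
  using assms
proof (induction rule: reaches.induct)
  case start
  show ?case by (rule reaches.start)
next
  case (step h q)
  then have "reaches n A V' (h @ [(q, answer V' q)])"
    by (intro reaches.step) auto
  then show ?case using step.prems[of q "answer V q"] by simp
qed

text \<open>Each transcript fixes the next query and the profile fixes its answer, so runs cannot
  branch.\<close>

lemma reaches_halts_prefix:
  assumes "reaches n A V h'" "halts n A V h b"
  shows "\<exists>g. h = h' @ g"
  using assms(1)
proof (induction rule: reaches.induct)
  case start
  show ?case by simp
next
  case (step h' q)
  then obtain g where g: "h = h' @ g" by blast
  have first: "g \<noteq> [] \<Longrightarrow> \<exists>q. A h' = Ask q \<and> hd g = (q, answer V q)"
    if "reaches n A V (h' @ g)" for g
    using that
  proof (induction "h' @ g" arbitrary: g rule: reaches.induct)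
    case (step h q)
    then show ?case
      by (cases g rule: rev_cases) (auto simp: hd_append)
  qed simp
  \<comment> \<open>The strategy asks at \<open>h'\<close> but outputs at \<open>h\<close>, so the
    two differ.\<close>
  have "g \<noteq> []" using g step assms(2) by (auto simp: halts_def)
  with first[of g] g assms(2) step show ?case
    by (cases g) (auto simp: halts_def)
qed

lemma halts_deterministic:
  assumes "halts n A V h b" "halts n A V h' b'"
  shows "b = b'"
proof -
  obtain g g' where "h = h' @ g" "h' = h @ g'"
    using reaches_halts_prefix assms unfolding halts_def by meson
  then have "h = h'" by simp
  with assms show ?thesis by (simp add: halts_def)
qed

section \<open>Allocations\<close>

text \<open>The pieces have total length at most 1, which is already the sum of the
  entitlements.\<close>

lemma not_strongly_proportional_lborel:
  assumes w: "sum w {1..n} = 1" and X: "connected_allocation n X"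
    and V: "\<And>i. i \<in> {1..n} \<Longrightarrow> V i = measure lborel"
  shows "\<not> strongly_proportional n w V X"
proof
  assume sp: "strongly_proportional n w V X"
  have n: "{1..n} \<noteq> {}" using w by force
  have cl: "\<exists>a b. X i = {a..b} \<and> 0 \<le> a \<and> a \<le> b \<and> b \<le> 1" if "i \<in> {1..n}" for i
    using X that by (auto simp: connected_allocation_def closed_intervals_def)
  \<comment> \<open>Pieces may share endpoints; their interiors are disjoint and have the same
    lengths.\<close>
  have int: "measure lborel (interior (X i)) = measure lborel (X i)"
    "interior (X i) \<subseteq> cake" if "i \<in> {1..n}" for i
    using cl[OF that] by (auto simp: cake_def)
  have "1 = sum w {1..n}" using w by simp
  also have "\<dots> < (\<Sum>i\<in>{1..n}. measure lborel (X i))"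
    using sp V n by (intro sum_strict_mono) (auto simp: strongly_proportional_def)
  also have "\<dots> = (\<Sum>i\<in>{1..n}. measure lborel (interior (X i)))"
    using int by simp
  also have "\<dots> = measure lborel (\<Union>i\<in>{1..n}. interior (X i))"
  proof (rule measure_UNION'[symmetric])
    show "pairwise (\<lambda>i j. disjnt (interior (X i)) (interior (X j))) {1..n}"
      using X unfolding connected_allocation_def allocation_def pairwise_def disjnt_def frontier_def
      by (smt (verit) Diff_iff Int_iff disjoint_iff interior_subset subset_iff)
    show "interior (X i) \<in> fmeasurable lborel" if "i \<in> {1..n}" for i
      using int[OF that] by (intro fmeasurable_lborel_subset_cake) auto
  qed simp
  also have "\<dots> \<le> measure lborel cake"
  proof (intro measure_mono_fmeasurable fmeasurable_lborel_subset_cake)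
    show "(\<Union>i\<in>{1..n}. interior (X i)) \<subseteq> cake" using int(2) by blast
  qed (auto simp: cake_def)
  also have "\<dots> = 1" by (simp add: cake_def)
  finally show False by simp
qed

text \<open>The pieces are laid side by side from left to right: first those of \<open>N\<close>,
  then that of \<open>i\<close>, then the rest.\<close>

lemma connected_allocation_with_lengths:
  fixes l :: "nat \<Rightarrow> real"
  assumes i: "i \<in> {1..n}" and N: "N \<subseteq> {1..n} - {i}"
    and l: "\<And>j. j \<in> {1..n} \<Longrightarrow> 0 < l j" "sum l {1..n} = 1"
  obtains X where "connected_allocation n X" "X i = {sum l N..sum l N + l i}"
    "\<And>j. j \<in> {1..n} \<Longrightarrow> \<exists>a. X j = {a..a + l j}"
proof -
  \<comment> \<open>Ranks encode this order: at most \<open>n\<close> on \<open>N\<close>, exactly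
    \<open>n + 1\<close> at \<open>i\<close>, larger elsewhere. \<open>P j\<close> collects the
    predecessors of \<open>j\<close>, and \<open>s j\<close> is the left end of its piece.\<close>
  define r where "r j = (if j \<in> N then j else if j = i then n + 1 else n + 1 + j)" for j
  have r_neq: "r j \<noteq> r k" if "j \<in> {1..n}" "k \<in> {1..n}" "j \<noteq> k" for j k
    using that N unfolding r_def by auto
  define P where "P j = {k \<in> {1..n}. r k < r j}" for j
  define s where "s j = sum l (P j)" for j
  define X where "X j = {s j..s j + l j}" for j
  have finP: "finite (P j)" "P j \<subseteq> {1..n}" "j \<notin> P j" for j by (auto simp: P_def)
  have sl: "s j + l j = sum l (insert j (P j))" for j
    using finP by (simp add: s_def)
  have s0: "0 \<le> s j" for j
    unfolding s_def using finP l(1) by (intro sum_nonneg) (meson less_imp_le subsetD)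
  have mono: "sum l K \<le> sum l K'" if "K \<subseteq> K'" "K' \<subseteq> {1..n}" for K K'
    using that l(1) finite_subset[OF that(2)] by (intro sum_mono2) (auto simp: subset_iff less_imp_le)
  have s1: "s j + l j \<le> 1" if "j \<in> {1..n}" for j
    using mono[of "insert j (P j)" "{1..n}"] that finP(2) l(2) by (auto simp: sl)
  have step: "s j + l j \<le> s k" if "j \<in> {1..n}" "r j < r k" for j k
    unfolding sl unfolding s_def
    by (rule mono) (use that in \<open>auto simp: P_def\<close>)
  have inter: "X j \<inter> X k \<subseteq> frontier (X j) \<inter> frontier (X k)"
    if jk: "j \<in> {1..n}" "k \<in> {1..n}" "r j < r k" for j k
    using step[OF jk(1,3)] l(1)[OF jk(1)] l(1)[OF jk(2)]
    by (auto simp: X_def frontier_def)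
  \<comment> \<open>The first piece in rank order whose right end reaches \<open>x\<close> contains
    \<open>x\<close>: its left end is 0 or the right end of its immediate predecessor, which falls
    short of \<open>x\<close>.\<close>
  have cover: "\<exists>j\<in>{1..n}. x \<in> X j" if x: "0 \<le> x" "x \<le> 1" for x
  proof -
    define S where "S = {j \<in> {1..n}. x \<le> s j + l j}"
    have "\<exists>j\<in>{1..n}. \<forall>k\<in>{1..n}. r k \<le> r j"
    proof -
      have "Max (r ` {1..n}) \<in> r ` {1..n}" using i by (intro Max_in) auto
      then obtain j where "j \<in> {1..n}" "r j = Max (r ` {1..n})" by force
      then show ?thesis by (metis Max_ge finite_atLeastAtMost finite_imageI imageI)
    qed
    then obtain m where m: "m \<in> {1..n}" "\<And>k. k \<in> {1..n} \<Longrightarrow> r k \<le> r m" by blast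
    \<comment> \<open>The last piece ends at 1, so \<open>S\<close> is nonempty.\<close>
    have "insert m (P m) = {1..n}"
      using m r_neq by (force simp: P_def order_less_le)
    then have "m \<in> S" using sl[of m] l(2) x m by (simp add: S_def)
    then obtain j where j: "j \<in> S" "\<And>k. k \<in> S \<Longrightarrow> r j \<le> r k"
      using ex_has_least_nat[of "\<lambda>j. j \<in> S" m r] by blast
    have "s j \<le> x"
    proof (cases "P j = {}")
      case True
      then show ?thesis using x by (simp add: s_def)
    next
      case False
      have "Max (r ` P j) \<in> r ` P j" using False finP by (intro Max_in) auto
      then obtain k where k: "k \<in> P j" "r k = Max (r ` P j)" by force
      then have kmax: "r k' \<le> r k" if "k' \<in> P j" for k' using that finP by simp
      have "insert k (P k) = P j"
        using k(1) kmax r_neq by (fastforce simp: P_def order_less_le)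
      then have "s j = s k + l k" unfolding sl by (simp add: s_def)
      moreover have "k \<notin> S" using j(2)[of k] k(1) by (auto simp: P_def)
      ultimately show ?thesis using k(1) by (auto simp: S_def P_def)
    qed
    with j(1) show ?thesis by (auto simp: S_def X_def)
  qed
  have closed: "X j \<in> closed_intervals" if "j \<in> {1..n}" for j
    unfolding X_def closed_intervals_def using s0[of j] s1[OF that] l(1)[OF that] by force
  show thesis
  proof
    show "connected_allocation n X"
      unfolding connected_allocation_def allocation_def
    proof (intro conjI ballI impI)
      have sub: "X j \<subseteq> cake" if "j \<in> {1..n}" for j
        using s0[of j] s1[OF that] by (auto simp: X_def cake_def)
      show "(\<Union>j\<in>{1..n}. X j) = cake"
      proof
        show "cake \<subseteq> (\<Union>j\<in>{1..n}. X j)" using cover by (auto simp: cake_def)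
      qed (use sub in blast)
    next
      fix j assume "j \<in> {1..n}"
      then show "\<exists>\<I>. finite \<I> \<and> \<I> \<subseteq> closed_intervals \<and> X j = \<Union>\<I>"
        using closed by (intro exI[of _ "{X j}"]) auto
    next
      fix j k assume jk: "j \<in> {1..n}" "k \<in> {1..n}" "j \<noteq> k"
      from r_neq[OF this] have "r j < r k \<or> r k < r j" by auto
      then show "X j \<inter> X k \<subseteq> frontier (X j) \<inter> frontier (X k)"
        using inter[of j k] inter[of k j] jk by blast
    qed (use closed in auto)
    have "P i = N" using N i by (auto simp: P_def r_def)
    then show "X i = {sum l N..sum l N + l i}" by (simp add: X_def s_def)
  qed (auto simp: X_def)
qed

text \<open>The interval of length \<open>w i\<close> starting at \<open>sum w N\<close> is worth
  more than \<open>w i\<close> to agent \<open>i\<close>. Trimming it slightly frees an extra length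
  \<open>c\<close> for each other agent, and the surplus absorbs the loss.\<close>

lemma strongly_proportional_tent_val:
  assumes ent: "entitlements n w" and i: "i \<in> {1..n}" and N: "N \<subseteq> {1..n} - {i}"
    and s: "\<bar>s\<bar> \<le> 1/2" and d: "0 \<le> d"
    and gain: "w i < tent_cdf p d s (sum w N + w i) - tent_cdf p d s (sum w N)"
    and Vi: "V i = tent_val p d s"
    and V: "\<And>j. j \<in> {1..n} \<Longrightarrow> j \<noteq> i \<Longrightarrow> V j = measure lborel"
  shows "\<exists>X. connected_allocation n X \<and> strongly_proportional n w V X"
proof -
  have w: "0 < w j" if "j \<in> {1..n}" for j using ent that by (auto simp: entitlements_def)
  define F where "F = tent_cdf p d s"
  define a where "a = sum w N"
  define g where "g = F (a + w i) - F a - w i"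
  have g: "0 < g" using gain by (simp add: g_def F_def a_def)
  \<comment> \<open>The trimmed length \<open>(n - 1) * c\<close> is at most \<open>g / 4\<close>,
    which at slope at most 2 costs at most \<open>g / 2\<close>. The bound by \<open>w i\<close>
    keeps \<open>l i\<close> positive.\<close>
  define c where "c = min g (w i) / (4 * real n)"
  have n: "1 \<le> n" using i by auto
  have c: "0 < c" using g w[OF i] n by (simp add: c_def)
  have nc: "real n * c \<le> g / 4" "real n * c \<le> w i / 4"
    using n by (auto simp: c_def field_simps)
  define l where "l j = (if j = i then w i - real (n - 1) * c else w j + c)" for j
  have n1c: "0 \<le> real (n - 1) * c" "real (n - 1) * c \<le> real n * c"
    using c by (auto intro!: mult_right_mono)
  have lpos: "0 < l j" if "j \<in> {1..n}" for j
    using w[OF that] w[OF i] c nc n1c unfolding l_def by (simp only: split: if_split) linarith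
  have suml: "sum l K = sum w K + real (card K) * c" if "i \<notin> K" for K
  proof -
    have "sum l K = sum (\<lambda>j. w j + c) K"
      by (rule sum.cong) (use that in \<open>auto simp: l_def\<close>)
    then show ?thesis by (simp add: sum.distrib)
  qed
  have "sum l {1..n} = l i + sum l ({1..n} - {i})"
    using i by (simp add: sum.remove)
  also have "\<dots> = w i + sum w ({1..n} - {i})"
    using i suml[of "{1..n} - {i}"] by (simp add: l_def[of i])
  also have "\<dots> = 1"
    using i ent by (simp add: sum.remove[symmetric] entitlements_def)
  finally have "sum l {1..n} = 1" .
  from connected_allocation_with_lengths[OF i N lpos this] obtain X where
    X: "connected_allocation n X" "X i = {sum l N..sum l N + l i}"
      "\<And>j. j \<in> {1..n} \<Longrightarrow> \<exists>a. X j = {a..a + l j}" by blast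
  have "card N \<le> n - 1"
    using card_mono[OF _ N] i by simp
  then have cardN: "real (card N) * c \<le> real (n - 1) * c"
    using c by (intro mult_right_mono) auto
  define x y where "x = sum l N" and "y = sum l N + l i"
  have xeq: "x = a + real (card N) * c" and yeq: "y = x + w i - real (n - 1) * c"
    using suml[of N] N by (auto simp: x_def y_def a_def l_def[of i])
  have x: "a \<le> x" using c by (simp add: xeq)
  have y: "y \<le> a + w i" "x \<le> y"
    using cardN nc n1c w[OF i] unfolding yeq xeq by linarith+
  \<comment> \<open>Trimming removes \<open>card N * c\<close> on the left and the rest of
    \<open>(n - 1) * c\<close> on the right.\<close>
  have "F x - F a \<le> 2 * (x - a)" "F (a + w i) - F y \<le> 2 * (a + w i - y)"
    unfolding F_def using tent_cdf_diff_bounds(2)[OF s x] tent_cdf_diff_bounds(2)[OF s y(1)] .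
  moreover have "x - a + (a + w i - y) \<le> g / 4"
    using order_trans[OF n1c(2) nc(1)] by (simp only: yeq)
  ultimately have "w i < F y - F x"
    using g unfolding g_def by argo
  moreover have "V i (X i) = F y - F x"
    using y(2) d by (simp add: Vi X(2) F_def x_def y_def tent_val_Icc)
  moreover have "w j < V j (X j)" if j: "j \<in> {1..n}" "j \<noteq> i" for j
  proof -
    from X(3)[OF j(1)] obtain b where "X j = {b..b + l j}" by blast
    then show ?thesis using V[OF j] lpos[OF j(1)] c j(2) by (simp add: l_def)
  qed
  ultimately have "strongly_proportional n w V X"
    unfolding strongly_proportional_def by metis
  with X(1) show ?thesis by blast
qed

section \<open>The lower bound\<close>

lemma sum_length_filter_le:
  fixes f :: "'a \<Rightarrow> 'b"
  assumes "finite I"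
  shows "(\<Sum>i\<in>I. length (filter (\<lambda>x. f x = i) xs)) \<le> length xs"
proof (induction xs)
  case (Cons x xs)
  have "(\<Sum>i\<in>I. length (filter (\<lambda>x. f x = i) (x # xs)))
      = (\<Sum>i\<in>I. (if f x = i then 1 else 0) + length (filter (\<lambda>x. f x = i) xs))"
    by (intro sum.cong) auto
  also have "\<dots> = (if f x \<in> I then 1 else 0) + (\<Sum>i\<in>I. length (filter (\<lambda>x. f x = i) xs))"
    using assms by (simp add: sum.distrib)
  finally show ?case using Cons by auto
qed simp

lemma card_UN_query_points_le:
  "card (\<Union>q\<in>set qs. query_points q) \<le> 2 * length qs"
proof (induction qs)
  case (Cons q qs)
  have "card (query_points q) \<le> 2" by (cases q) (auto simp: card_insert_if)
  then show ?case
    using Cons card_Un_le[of "query_points q" "\<Union>q\<in>set qs. query_points q"] by simp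
qed simp

text \<open>Pigeonhole twice, over agents and then over points. The sets \<open>{}\<close> and
  \<open>{1..n}\<close> are excluded because they give the ends 0 and 1 of the cake, where no tent
  fits.\<close>

lemma unqueried_point:
  assumes n: "n \<ge> 2" and gen: "generic n w" and short: "length qs < n * 2 ^ (n - 2)"
  obtains i M where "i \<in> {1..n}" "M \<subseteq> {1..n}" "M \<noteq> {}" "M \<noteq> {1..n}"
    "\<And>q. q \<in> set qs \<Longrightarrow> query_agent q = i \<Longrightarrow> sum w M \<notin> query_points q"
proof -
  have "\<exists>i\<in>{1..n}. length (filter (\<lambda>q. query_agent q = i) qs) < 2 ^ (n - 2)"
  proof (rule ccontr)
    assume "\<not> ?thesis"
    then have "(\<Sum>i\<in>{1..n}. 2 ^ (n - 2))
        \<le> (\<Sum>i\<in>{1..n}. length (filter (\<lambda>q. query_agent q = i) qs))"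
      by (intro sum_mono) (simp add: not_less)
    also have "\<dots> \<le> length qs" by (rule sum_length_filter_le) simp
    finally show False using short by simp
  qed
  then obtain i where i: "i \<in> {1..n}" "length (filter (\<lambda>q. query_agent q = i) qs) < 2 ^ (n - 2)"
    by blast
  define Q where "Q = (\<Union>q\<in>set (filter (\<lambda>q. query_agent q = i) qs). query_points q)"
  have "finite (query_points q)" for q by (cases q) auto
  then have finQ: "finite Q" by (auto simp: Q_def)
  define MM where "MM = Pow {1..n} - {{}, {1..n}}"
  have "inj_on (sum w) MM"
    using gen by (auto simp: inj_on_def generic_def MM_def)
  then have "card (sum w ` MM) = card MM" by (rule card_image)
  also have "\<dots> = 2 ^ n - 2"
    unfolding MM_def using n by (subst card_Diff_subset) (auto simp: card_Pow)
  finally have cardMM: "card (sum w ` MM) = 2 ^ n - 2" .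
  obtain k where k: "n = Suc (Suc k)" using n by (metis add_2_eq_Suc le_Suc_ex)
  have "card Q < 2 * 2 ^ (n - 2)"
    using card_UN_query_points_le[of "filter (\<lambda>q. query_agent q = i) qs"] i(2) by (simp add: Q_def)
  \<comment> \<open>With \<open>n = k + 2\<close> this reads
    \<open>2 * 2 ^ k \<le> 4 * 2 ^ k - 2\<close>, an equality for \<open>n = 2\<close>.\<close>
  also have "\<dots> \<le> 2 ^ n - 2" using one_le_power[of "2::nat" k] unfolding k by (simp, linarith)
  finally have "\<not> sum w ` MM \<subseteq> Q" using card_mono[OF finQ] cardMM by (metis not_less)
  then obtain M where "M \<in> MM" "sum w M \<notin> Q" by blast
  with i(1) show thesis by (intro that[of i M]) (auto simp: MM_def Q_def)
qed

theorem theorem5: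
  fixes n :: nat and w :: "nat \<Rightarrow> real" and A :: algorithm
  assumes "n \<ge> 2"
    and "entitlements n w"
    and "generic n w"
    and "decides_connected_strongly_proportional n w A"
  shows "\<exists>V h b. hungry_profile n V \<and> halts n A V h b \<and> n * 2 ^ (n - 2) \<le> length h"
proof -
  have w: "0 < w j" if "j \<in> {1..n}" for j using assms(2) that by (auto simp: entitlements_def)
  have w1: "sum w {1..n} = 1" using assms(2) by (simp add: entitlements_def)
  have decides: "\<exists>h. halts n A V h (\<exists>X. connected_allocation n X \<and> strongly_proportional n w V X)"
    if "hungry_profile n V" for V
    using assms(4) that by (simp add: decides_connected_strongly_proportional_def)
  define U where "U = (\<lambda>_::nat. measure (lborel :: real measure))"
  \<comment> \<open>At \<open>s = 0\<close> the parameters \<open>p\<close> and \<open>d\<close> are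
    free, so they can later be matched to those of the perturbation.\<close>
  have U: "U j = tent_val p d 0" for j p d by (simp add: U_def tent_val_0)
  have vU: "valuation (U j)" "hungry (U j)" for j
    using valuation_tent_val[of 0 0 0] hungry_tent_val[of 0 0 0] by (simp_all add: U[of j 0 0])
  have hU: "hungry_profile n U" by (simp add: hungry_profile_def vU)
  have "\<not> (\<exists>X. connected_allocation n X \<and> strongly_proportional n w U X)"
    using not_strongly_proportional_lborel[OF w1, of _ U] by (auto simp: U_def)
  with decides[OF hU] obtain h where h: "halts n A U h False" by auto
  have "\<not> length h < n * 2 ^ (n - 2)"
  proof
    assume "length h < n * 2 ^ (n - 2)"
    then have "length (map fst h) < n * 2 ^ (n - 2)" by simp
    from unqueried_point[OF assms(1,3) this] obtain i M where
      i: "i \<in> {1..n}" and M: "M \<subseteq> {1..n}" "M \<noteq> {}" "M \<noteq> {1..n}" and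
      unq: "\<And>q. q \<in> set (map fst h) \<Longrightarrow> query_agent q = i \<Longrightarrow> sum w M \<notin> query_points q"
      by blast
    define p where "p = sum w M"
    have finM: "finite M" using M finite_subset by blast
    have p0: "0 < p"
      unfolding p_def using finM M w by (intro sum_pos) auto
    have "0 < sum w ({1..n} - M)" using M w by (intro sum_pos) auto
    then have p1: "p < 1"
      using sum.subset_diff[OF M(1), of w] w1 by (simp add: p_def)
    define Q where "Q = (\<Union>q\<in>{q \<in> set (map fst h). query_agent q = i}. query_points q)"
    have "finite (query_points q)" for q by (cases q) auto
    then have "finite Q" by (auto simp: Q_def)
    from finite_set_avoid[OF this, of p] obtain e where
      e: "0 < e" "\<And>x. x \<in> Q \<Longrightarrow> x \<noteq> p \<Longrightarrow> e \<le> dist p x" by blast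
    have "p \<notin> Q" using unq by (auto simp: Q_def p_def)
    \<comment> \<open>The bound \<open>e\<close> keeps query points out of the open tent,
      \<open>p\<close> and \<open>1 - p\<close> keep the tent inside the cake, and
      \<open>w i\<close> puts the other end of the interval of length \<open>w i\<close> at
      \<open>p\<close> outside the tent.\<close>
    define d where "d = Min {e, p, 1 - p, w i}"
    have d: "0 < d" "d \<le> e" "d \<le> p" "p + d \<le> 1" "d \<le> w i"
      using e(1) p0 p1 w[OF i] by (auto simp: d_def)
    have far: "d \<le> \<bar>x - p\<bar>" if "x \<in> Q" for x
      using e(2)[OF that] that \<open>p \<notin> Q\<close> d(2) by (fastforce simp: dist_real_def)
    \<comment> \<open>Value moves to the side of \<open>p\<close> on which agent \<open>i\<close> is
      to be served.\<close>
    define s :: real where "s = (if i \<in> M then 1/2 else -1/2)"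
    have s: "\<bar>s\<bar> \<le> 1/2" by (simp add: s_def)
    define V where "V = U(i := tent_val p d s)"
    have hV: "hungry_profile n V"
      using vU valuation_tent_val[OF s, of d p] hungry_tent_val[OF s] d
      by (auto simp: hungry_profile_def V_def)
    have same: "answer U q = answer V q" if "(q, a) \<in> set h" for q a
    proof (cases "query_agent q = i")
      case True
      have legal: "legal_query n q" using reaches_legal h that by (auto simp: halts_def)
      have "q \<in> set (map fst h)" using that by force
      with True have "\<And>x. x \<in> query_points q \<Longrightarrow> d \<le> \<bar>x - p\<bar>"
        using far by (auto simp: Q_def)
      with answer_tent_val[of 0 d p U q n, OF _ _ _ _ U legal]
        answer_tent_val[of s d p V q n, OF s _ _ _ _ legal] d True
      show ?thesis by (simp add: V_def)
    next
      case False
      then show ?thesis by (intro answer_cong_agent) (simp add: V_def)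
    qed
    have hVF: "halts n A V h False"
      using h reaches_cong[of n A U h V] same by (auto simp: halts_def)
    have tp: "tent_cdf p d s p = p + s * d" using d(1) by (simp add: tent_cdf_def)
    \<comment> \<open>The interval is \<open>{p - w i..p}\<close> if \<open>i\<close> is in
      \<open>M\<close> and \<open>{p..p + w i}\<close> otherwise; either way the gain is
      \<open>d / 2\<close>.\<close>
    have "w i < tent_cdf p d s (sum w (M - {i}) + w i) - tent_cdf p d s (sum w (M - {i}))"
    proof (cases "i \<in> M")
      case True
      then have "sum w (M - {i}) = p - w i" using finM by (simp add: p_def sum_diff1)
      then show ?thesis using True d tp by (simp add: tent_cdf_eq_self s_def)
    next
      case False
      then have "sum w (M - {i}) = p" by (simp add: p_def)
      then show ?thesis using False d tp by (simp add: tent_cdf_eq_self s_def)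
    qed
    then have "\<exists>X. connected_allocation n X \<and> strongly_proportional n w V X"
      using M d by (intro strongly_proportional_tent_val[OF assms(2) i _ s])
        (auto simp: V_def U_def)
    \<comment> \<open>Correctness on \<open>V\<close> demands the verdict \<open>True\<close>, but
      the run copied from \<open>U\<close> ends with \<open>False\<close>.\<close>
    with decides[OF hV] obtain h' where "halts n A V h' True" by auto
    with hVF show False using halts_deterministic by blast
  qed
  with h hU show ?thesis by (meson not_less)
qed

end
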